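(* Let $n\ge 2$. Every third order $n$-dimensional completely positive tensor is a third order positive semi-definite symmetric tensor. Furthermore, suppose $\mathcal{A}=(a_{ijk})$ is a third order completely positive tensor of the form $\mathcal{A}=\sum_{l=1}^r (\mathbf{u}^{(l)})^3$ with nonnegative vectors $\mathbf{u}^{(1)},\dots,\mathbf{u}^{(r)}\in\mathbb{R}^n$, and for each $i\in\{1,\dots,n\}$ let $\Gamma_i:=\{l\in\{1,\dots,r\}: u^{(l)}_i\neq 0\}$. If for every $i\in\{1,\dots,n\}$ the matrix $[\mathbf{u}^{(l)}]_{l\in\Gamma_i}$ with columns $\mathbf{u}^{(l)}$, $l\in\Gamma_i$, has rank $n$, then $\mathcal{A}$ is a third order positive definite symmetric tensor.
   Context: For $\mathbf{u}=(u_1,\dots,u_n)^\top\in\mathbb{R}^n$, $\mathbf{u}^3$ denotes the third order tensor $(u_iu_ju_k)$. A third order tensor $\mathcal{A}$ is completely positive if there are a positive integer $r$ and (entrywise) nonnegative vectors $\mathbf{u}^{(1)},\dots,\mathbf{u}^{(r)}\in\mathbb{R}^n$ with $\mathcal{A}=\sum_{l=1}^r(\mathbf{u}^{(l)})^3$. A third order $n$-dimensional complex tensor $\mathcal{A}=(a_{ijk})$ is Hermitian if $a_{ijk}=a_{jki}=a_{kij}=a_{jik}^*=a_{ikj}^*=a_{kji}^*$ for all $i,j,k$ ($^*$ is complex conjugation). For Hermitian $\mathcal{A}$ define $F:\mathbb{C}^n\to\mathbb{R}^n$ by $F(x)=y$ with $y_i=\sum_{j,k=1}^n a_{ijk}x_j^*x_k$.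 A Hermitian $\mathcal{A}$ is positive semi-definite if all components of $F(x)$ are nonnegative for every $x\in\mathbb{C}^n$, and positive definite if all components of $F(x)$ are strictly positive for every nonzero $x\in\mathbb{C}^n$. A third order positive semi-definite (resp. positive definite) symmetric tensor is a positive semi-definite (resp. positive definite) Hermitian tensor all of whose entries are real. *)

theory Defs
  imports "HOL-Analysis.Analysis"
begin

text \<open>Third order tensors of dimension \<open>CARD('n)\<close> are \<open>complex ^ 'n ^ 'n ^ 'n\<close>; real tensors are
  those whose entries lie in \<open>\<real>\<close>.\<close>

definition tensor_cube :: "real ^ 'n \<Rightarrow> complex ^ 'n ^ 'n ^ 'n" where
  "tensor_cube u = (\<chi> i j k. complex_of_real (u $ i * u $ j * u $ k))"

definition completely_positive :: "complex ^ 'n ^ 'n ^ 'n \<Rightarrow> bool" where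
  "completely_positive A \<longleftrightarrow>
     (\<exists>r::nat. \<exists>u :: nat \<Rightarrow> real ^ 'n.
        1 \<le> r \<and> (\<forall>l\<in>{1..r}. \<forall>i. 0 \<le> u l $ i) \<and> A = (\<Sum>l=1..r. tensor_cube (u l)))"

definition hermitian_tensor :: "complex ^ 'n ^ 'n ^ 'n \<Rightarrow> bool" where
  "hermitian_tensor A \<longleftrightarrow>
     (\<forall>i j k. A $ i $ j $ k = A $ j $ k $ i \<and>
              A $ i $ j $ k = A $ k $ i $ j \<and>
              A $ i $ j $ k = cnj (A $ j $ i $ k) \<and>
              A $ i $ j $ k = cnj (A $ i $ k $ j) \<and>
              A $ i $ j $ k = cnj (A $ k $ j $ i))"

text \<open>For Hermitian \<open>A\<close> the sum below is real, so taking the real part only adjusts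
  the type; see \<open>tensor_map_eq\<close>.\<close>

definition tensor_map :: "complex ^ 'n ^ 'n ^ 'n \<Rightarrow> complex ^ 'n \<Rightarrow> real ^ 'n" where
  "tensor_map A x = (\<chi> i. Re (\<Sum>j\<in>UNIV. \<Sum>k\<in>UNIV. A $ i $ j $ k * cnj (x $ j) * x $ k))"

lemma tensor_map_eq:
  fixes A :: "complex ^ 'n ^ 'n ^ 'n"
  assumes "hermitian_tensor A"
  shows "complex_of_real (tensor_map A x $ i) =
           (\<Sum>j\<in>UNIV. \<Sum>k\<in>UNIV. A $ i $ j $ k * cnj (x $ j) * x $ k)" (is "_ = ?S")
proof -
  have herm: "cnj (A $ i $ j $ k) = A $ i $ k $ j" for j k
    using assms unfolding hermitian_tensor_def by (metis complex_cnj_cnj)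
  have "cnj ?S = (\<Sum>j\<in>UNIV. \<Sum>k\<in>UNIV. A $ i $ k $ j * cnj (x $ k) * x $ j)"
    by (simp add: herm mult_ac)
  also have "\<dots> = ?S"
    by (rule sum.swap)
  finally have "?S \<in> \<real>"
    by (simp add: Reals_cnj_iff)
  then show ?thesis
    unfolding tensor_map_def vec_lambda_beta by (rule of_real_Re)
qed

definition psd_hermitian_tensor :: "complex ^ 'n ^ 'n ^ 'n \<Rightarrow> bool" where
  "psd_hermitian_tensor A \<longleftrightarrow> hermitian_tensor A \<and> (\<forall>x i. 0 \<le> tensor_map A x $ i)"

definition pd_hermitian_tensor :: "complex ^ 'n ^ 'n ^ 'n \<Rightarrow> bool" where
  "pd_hermitian_tensor A \<longleftrightarrow> hermitian_tensor A \<and> (\<forall>x. x \<noteq> 0 \<longrightarrow> (\<forall>i. 0 < tensor_map A x $ i))"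

definition psd_symmetric_tensor :: "complex ^ 'n ^ 'n ^ 'n \<Rightarrow> bool" where
  "psd_symmetric_tensor A \<longleftrightarrow> psd_hermitian_tensor A \<and> (\<forall>i j k. A $ i $ j $ k \<in> \<real>)"

definition pd_symmetric_tensor :: "complex ^ 'n ^ 'n ^ 'n \<Rightarrow> bool" where
  "pd_symmetric_tensor A \<longleftrightarrow> pd_hermitian_tensor A \<and> (\<forall>i j k. A $ i $ j $ k \<in> \<real>)"

definition active_indices :: "nat \<Rightarrow> (nat \<Rightarrow> real ^ 'n) \<Rightarrow> 'n \<Rightarrow> nat set" where
  "active_indices r u i = {l \<in> {1..r}. u l $ i \<noteq> 0}"

text \<open>Rank (as column rank) of the matrix with columns \<open>u l\<close>, \<open>l \<in> S\<close>. The library's \<open>rank\<close> requires the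
  columns to be indexed by a whole type, whereas here the index set \<open>S\<close> varies; the two agree
  by \<open>columns_rank_eq_rank\<close> whenever a type is used to enumerate \<open>S\<close>.\<close>

definition columns_rank :: "('l \<Rightarrow> real ^ 'n) \<Rightarrow> 'l set \<Rightarrow> nat" where
  "columns_rank u S = dim (span (u ` S))"

lemma columns_rank_eq_rank:
  fixes u :: "'l \<Rightarrow> real ^ 'n" and f :: "'c::finite \<Rightarrow> 'l"
  assumes "bij_betw f UNIV S"
  shows "columns_rank u S = rank (\<chi> i c. u (f c) $ i)"
proof -
  have "columns (\<chi> i c. u (f c) $ i) = u ` range f"
    by (auto simp: columns_def column_def)
  then show ?thesis
    using assms by (simp add: columns_rank_def column_rank_def bij_betw_def)
qed

end

theory Submission
  imports Defs
begin

text \<open>Contracting the cube of a real vector \<open>u\<close> with \<open>x\<^sup>*\<close> and \<open>x\<close> in the last two slots gives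
  \<open>u\<^sub>i \<bar>u\<^sup>T x\<bar>\<^sup>2\<close>, so \<open>F(x)\<^sub>i\<close> is a sum of nonnegative terms. It vanishes only if \<open>x\<close> is orthogonal to
  every \<open>u\<^sup>l\<close> with \<open>l \<in> \<Gamma>\<^sub>i\<close>, and these span the whole space under the rank hypothesis.\<close>

text \<open>The double sum factors as the conjugate of s times s, scaled by the i-th entry of
  \<open>u\<close>, with s = u^T x. As \<open>u\<close> is real, Re s and Im s are the inner
  products of \<open>u\<close> with the real and imaginary parts of \<open>x\<close>; this moves the
  later arguments into real space, where \<open>columns_rank\<close> lives.\<close>

lemma tensor_map_tensor_cube:
  fixes u :: "real ^ 'n" and x :: "complex ^ 'n"
  shows "tensor_map (tensor_cube u) x $ i =
    u $ i * ((u \<bullet> (\<chi> j. Re (x $ j)))\<^sup>2 + (u \<bullet> (\<chi> j. Im (x $ j)))\<^sup>2)"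
  unfolding inner_vec_def power2_eq_square sum_product
  by (simp add: tensor_map_def tensor_cube_def sum_distrib_left algebra_simps flip: sum.distrib)

lemma tensor_map_sum:
  "tensor_map (\<Sum>l\<in>L. A l) x = (\<Sum>l\<in>L. tensor_map (A l) x)"
proof (induction L rule: infinite_finite_induct)
  case (insert l L)
  have "tensor_map (B + C) x = tensor_map B x + tensor_map C x" for B C
    by (simp add: tensor_map_def vec_eq_iff algebra_simps sum.distrib)
  with insert show ?case by simp
qed (simp_all add: tensor_map_def vec_eq_iff)

lemma sum_tensor_cube_nth:
  "(\<Sum>l\<in>L. tensor_cube (u l)) $ i $ j $ k
    = complex_of_real (\<Sum>l\<in>L. u l $ i * u l $ j * u l $ k)"
  by (simp add: tensor_cube_def)

text \<open>The entries are real, so conjugation fixes them, and permuting indices only permutes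
  factors.\<close>

lemma hermitian_sum_tensor_cube: "hermitian_tensor (\<Sum>l\<in>L. tensor_cube (u l))"
  unfolding hermitian_tensor_def sum_tensor_cube_nth complex_cnj_complex_of_real
  by (simp only: mult_ac simp_thms)

lemma tensor_map_sum_tensor_cube:
  "tensor_map (\<Sum>l\<in>L. tensor_cube (u l)) x $ i =
    (\<Sum>l\<in>L. u l $ i * ((u l \<bullet> (\<chi> j. Re (x $ j)))\<^sup>2 + (u l \<bullet> (\<chi> j. Im (x $ j)))\<^sup>2))"
  by (simp add: tensor_map_sum tensor_map_tensor_cube)

lemma psd_sum_tensor_cube:
  assumes "\<And>l i. l \<in> L \<Longrightarrow> 0 \<le> u l $ i"
  shows "psd_symmetric_tensor (\<Sum>l\<in>L. tensor_cube (u l))"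
  unfolding psd_symmetric_tensor_def psd_hermitian_tensor_def
  \<comment> \<open>The deleted rules would push \<open>$\<close> and \<open>of_real\<close> into
    the sum, hiding the shape that shows an entry to be real.\<close>
  by (auto simp: hermitian_sum_tensor_cube tensor_map_sum_tensor_cube sum_tensor_cube_nth
      simp del: sum_component of_real_sum intro!: sum_nonneg mult_nonneg_nonneg assms)

text \<open>\<open>y\<close> lies in the span itself, hence is orthogonal to itself.\<close>

lemma orthogonal_full_span_eq_0:
  fixes y :: "'a :: euclidean_space"
  assumes "span S = UNIV" and "\<And>v. v \<in> S \<Longrightarrow> v \<bullet> y = 0"
  shows "y = 0"
proof -
  have "orthogonal y y"
    by (rule orthogonal_to_span[of _ S]) (use assms in \<open>auto simp: orthogonal_def inner_commute\<close>)
  then show ?thesis by (simp add: orthogonal_def)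
qed

lemma pd_sum_tensor_cube:
  fixes u :: "'l \<Rightarrow> real ^ 'n"
  assumes "finite L" and nonneg: "\<And>l i. l \<in> L \<Longrightarrow> 0 \<le> u l $ i"
    and rank: "\<And>i. columns_rank u {l \<in> L. u l $ i \<noteq> 0} = CARD('n)"
  shows "pd_symmetric_tensor (\<Sum>l\<in>L. tensor_cube (u l))" (is "pd_symmetric_tensor ?A")
proof -
  have psd: "psd_symmetric_tensor ?A"
    using nonneg by (rule psd_sum_tensor_cube)
  have "0 < tensor_map ?A x $ i" if "x \<noteq> 0" for x i
  proof (rule ccontr)
    let ?re = "\<chi> j. Re (x $ j)" and ?im = "\<chi> j. Im (x $ j)"
    let ?S = "u ` {l \<in> L. u l $ i \<noteq> 0}"
    assume "\<not> 0 < tensor_map ?A x $ i"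
    with psd have "tensor_map ?A x $ i = 0"
      by (auto simp: psd_symmetric_tensor_def psd_hermitian_tensor_def not_less intro: antisym)
    then have "\<forall>l\<in>L. u l $ i * ((u l \<bullet> ?re)\<^sup>2 + (u l \<bullet> ?im)\<^sup>2) = 0"
      unfolding tensor_map_sum_tensor_cube
      by (subst (asm) sum_nonneg_eq_0_iff) (use assms in auto)
    \<comment> \<open>An active index has a nonzero factor \<open>u l $ i\<close>, so the sum of the
      two squares vanishes, and with it each square.\<close>
    then have orth: "v \<bullet> ?re = 0" "v \<bullet> ?im = 0" if "v \<in> ?S" for v
      using that by auto
    have "span ?S = UNIV"
      using rank[of i] by (subst dim_eq_full [symmetric]) (simp add: columns_rank_def)
    then have "?re = 0" "?im = 0"
      using orth by (simp_all only: orthogonal_full_span_eq_0)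
    with \<open>x \<noteq> 0\<close> show False
      by (simp add: vec_eq_iff complex_eq_iff)
  qed
  with psd show ?thesis
    by (simp add: psd_symmetric_tensor_def psd_hermitian_tensor_def
        pd_symmetric_tensor_def pd_hermitian_tensor_def)
qed

theorem theorem3p3:
  assumes "2 \<le> CARD('n::finite)"
  shows "(\<forall>A :: complex ^ 'n ^ 'n ^ 'n. completely_positive A \<longrightarrow> psd_symmetric_tensor A) \<and>
         (\<forall>(A :: complex ^ 'n ^ 'n ^ 'n) (r :: nat) (u :: nat \<Rightarrow> real ^ 'n).
            1 \<le> r \<longrightarrow>
            (\<forall>l\<in>{1..r}. \<forall>i. 0 \<le> u l $ i) \<longrightarrow>
            A = (\<Sum>l=1..r. tensor_cube (u l)) \<longrightarrow>
            (\<forall>i. columns_rank u (active_indices r u i) = CARD('n)) \<longrightarrow>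
            pd_symmetric_tensor A)"
proof (intro conjI allI impI)
  fix A :: "complex ^ 'n ^ 'n ^ 'n"
  assume "completely_positive A"
  then show "psd_symmetric_tensor A"
    \<comment> \<open>Membership in \<open>{1..r}\<close> stays folded to match
      \<open>l \<in> L\<close> in the lemma.\<close>
    unfolding completely_positive_def by (auto simp del: atLeastAtMost_iff intro: psd_sum_tensor_cube)
next
  fix A :: "complex ^ 'n ^ 'n ^ 'n" and r :: nat and u :: "nat \<Rightarrow> real ^ 'n"
  assume "\<forall>l\<in>{1..r}. \<forall>i. 0 \<le> u l $ i" "A = (\<Sum>l=1..r. tensor_cube (u l))"
    "\<forall>i. columns_rank u (active_indices r u i) = CARD('n)"
  then show "pd_symmetric_tensor A"
    unfolding active_indices_def by (simp add: pd_sum_tensor_cube del: atLeastAtMost_iff)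
qed

end
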